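(* Let $\mathcal{A}=(V,\Sigma,\delta)$ be a parameterized arena complete for enabled actions, $t\in V$ a target vertex, $\mathbb{K}$ any $\mathcal{A}$-coherent set, and let $W^\infty$, $W_{\mathrm{Alt}}^\infty$, $W_{\mathbb{K}}^\infty$ be the limits of the (eventually constant) sequences defined below. Then these three antichains are equal and describe the maximal elements of Eve's winning region in the knowledge game $\mathcal{K}$: for every $v\in V$ and nonempty $K\subseteq\mathbb{N}_{\geq1}$, Eve has a winning strategy from $(v,K)$ in $\mathcal{K}$ if and only if there exists $(v,K')\in W^\infty$ with $K\subseteq K'$.
   Context: $\mathbb{N}_{\geq 1}$ denotes the positive integers. A parameterized arena is $\mathcal{A}=(V,\Sigma,\delta)$ with $V$ finite, $\Sigma$ finite, $\delta:V\times\Sigma\times\mathbb{N}_{\geq1}\to 2^V$; $\mathrm{En}(v)$ is the set of $a$ with $\delta(v,a,k)\neq\emptyset$ for some $k$; complete for enabled actions means $a\in\mathrm{En}(v)$ implies $\delta(v,a,k)\neq\emptyset$ for all $k$. Let $\nabla(v,a,v')=\{k\mid v'\in\delta(v,a,k)\}$, assumed to be finite unions of intervals, and for $V'\subseteq V$, $\nabla(v,a,V')=\bigcap_{v'\in V'}\nabla(v,a,v')\setminus\bigcup_{v'\notin V'}\nabla(v,a,v')$ (empty intersection is $\mathbb{N}_{\geq1}$). Knowledge game $\mathcal{K}$: two-player turn-based reachability game; Eve's vertices $(v,K)$ ($v\in V$, $K\subseteq\mathbb{N}_{\geq1}$), Adam's vertices $(v,K,a)$; edges $(v,K)\to(v,K,a)$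 for $a\in\mathrm{En}(v)$, and $(v,K,a)\to(v',K\cap\nabla(v,a,v'))$ whenever $K\cap\nabla(v,a,v')\neq\emptyset$; targets are all $(t,K)$. Eve wins from a vertex if she has a strategy such that every consistent play from it reaches a target. $\mathcal{A}$-coherent set: $\mathbb{K}\subseteq 2^{\mathbb{N}_{\geq1}}$ containing $\mathbb{N}_{\geq1}$, $\emptyset$ and every $\nabla(v,a,v')$, closed under union, intersection, set difference. $V_E^{\mathbb{K}}=\{(u,K)\mid u\in V,K\in\mathbb{K}\}$ ordered by $(u,K)\preceq(u',K')$ iff $u=u'$, $K\subseteq K'$. For $L\subseteq V_E^{\mathbb{K}}$: $\mathrm{Dom}(L)=\{x\in V_E^{\mathbb{K}}\mid\exists x'\in L,\ x\preceq x',\ x\neq x'\}$, $\lceil L\rceil=L\setminus\mathrm{Dom}(L)$, $\downarrow_{\mathbb{K}}L=L\cup\mathrm{Dom}(L)$, $L\sqcup L'=\lceil L\cup L'\rceil$. Operators: $\mathrm{KPred}^{\mathbb{K}}_{v,a}(S)=\{K\in\mathbb{K}\mid\forall v'\in V:(v',K\cap\nabla(v,a,v'))\in S\}$; $\mathrm{Pred}^{\mathbb{K}}(S)=\bigcup_{v}\bigcup_{a\in\mathrm{En}(v)}\{(v,K)\mid K\in\mathrm{KPred}^{\mathbb{K}}_{v,a}(S)\}$. $\mathrm{KPredAlt}_{v,a}(S)=\{\bigcup_{V'\subseteq V}(\nabla(v,a,V')\cap\bigcap_{v'\in V'}K_{v'})\mid$ for each $v'\in V$, $(v',K_{v'})\in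 S\}$; $\mathrm{PredAlt}(S)=\bigcup_v\bigcup_{a\in\mathrm{En}(v)}\{(v,K)\mid K\in\mathrm{KPredAlt}_{v,a}(S)\}$. Sequences: all start from $\{(t,\mathbb{N}_{\geq1})\}\cup\{(v,\emptyset)\mid v\in V\setminus\{t\}\}$; $W_{\mathbb{K}}^{i+1}=W_{\mathbb{K}}^i\sqcup\mathrm{Pred}^{\mathbb{K}}(\downarrow_{\mathbb{K}}W_{\mathbb{K}}^i)$; $W^i$ is $W^i_{\mathbb{K}}$ for $\mathbb{K}=2^{\mathbb{N}_{\geq1}}$; $W_{\mathrm{Alt}}^{i+1}=W_{\mathrm{Alt}}^i\sqcup\mathrm{PredAlt}(W_{\mathrm{Alt}}^i)$. $X^\infty$ denotes the eventual value of an eventually constant sequence $(X^i)$. *)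

theory Defs
  imports Complex_Main
begin

text \<open>The positive integers are the subset \<open>{1..}\<close> of type \<^typ>\<open>nat\<close>; values of \<open>delta\<close>
  outside \<open>verts \<times> acts \<times> {1..}\<close> are irrelevant junk.\<close>

abbreviation Npos :: "nat set" where
  "Npos \<equiv> {1..}"

record ('v, 'a) arena =
  verts :: "'v set"
  acts :: "'a set"
  delta :: "'v \<Rightarrow> 'a \<Rightarrow> nat \<Rightarrow> 'v set"

definition En :: "('v, 'a) arena \<Rightarrow> 'v \<Rightarrow> 'a set" where
  "En A v = {a \<in> acts A. \<exists>k\<in>Npos. delta A v a k \<noteq> {}}"

definition nabla :: "('v, 'a) arena \<Rightarrow> 'v \<Rightarrow> 'a \<Rightarrow> 'v \<Rightarrow> nat set" where
  "nabla A v a v' = {k \<in> Npos. v' \<in> delta A v a k}"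

text \<open>The intersection with \<^term>\<open>Npos\<close> fixes the value of the empty intersection.\<close>

definition nabla_set :: "('v, 'a) arena \<Rightarrow> 'v \<Rightarrow> 'a \<Rightarrow> 'v set \<Rightarrow> nat set" where
  "nabla_set A v a V' =
     (Npos \<inter> (\<Inter>v'\<in>V'. nabla A v a v')) - (\<Union>v'\<in>verts A - V'. nabla A v a v')"

definition interval_Npos :: "nat set \<Rightarrow> bool" where
  "interval_Npos I \<longleftrightarrow> (\<exists>m\<ge>1. I = {m..} \<or> (\<exists>n. I = {m..n}))"

definition finite_union_of_intervals :: "nat set \<Rightarrow> bool" where
  "finite_union_of_intervals X \<longleftrightarrow>
     (\<exists>\<I>. finite \<I> \<and> (\<forall>I\<in>\<I>. interval_Npos I) \<and> X = \<Union>\<I>)"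

definition param_arena :: "('v, 'a) arena \<Rightarrow> bool" where
  "param_arena A \<longleftrightarrow>
     finite (verts A) \<and> finite (acts A) \<and>
     (\<forall>v\<in>verts A. \<forall>a\<in>acts A. \<forall>k\<in>Npos. delta A v a k \<subseteq> verts A) \<and>
     (\<forall>v\<in>verts A. \<forall>a\<in>acts A. \<forall>v'\<in>verts A. finite_union_of_intervals (nabla A v a v'))"

definition complete_for_enabled :: "('v, 'a) arena \<Rightarrow> bool" where
  "complete_for_enabled A \<longleftrightarrow>
     (\<forall>v\<in>verts A. \<forall>a\<in>En A v. \<forall>k\<in>Npos. delta A v a k \<noteq> {})"


section \<open>Turn-based reachability games\<close>

record 'x game =
  eve :: "'x set"
  adam :: "'x set"
  edges :: "('x \<times> 'x) set"
  targets :: "'x set"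

definition fin_path :: "'x game \<Rightarrow> 'x list \<Rightarrow> bool" where
  "fin_path G h \<longleftrightarrow>
     h \<noteq> [] \<and> set h \<subseteq> eve G \<union> adam G \<and> (\<forall>i. Suc i < length h \<longrightarrow> (h ! i, h ! Suc i) \<in> edges G)"

definition inf_path :: "'x game \<Rightarrow> (nat \<Rightarrow> 'x) \<Rightarrow> bool" where
  "inf_path G p \<longleftrightarrow> range p \<subseteq> eve G \<union> adam G \<and> (\<forall>i. (p i, p (Suc i)) \<in> edges G)"

definition deadlock :: "'x game \<Rightarrow> 'x \<Rightarrow> bool" where
  "deadlock G x \<longleftrightarrow> (\<forall>y. (x, y) \<notin> edges G)"

text \<open>Strategies may depend on the whole history; no move is required at a vertex without
  successors.\<close>

definition eve_strategy :: "'x game \<Rightarrow> ('x list \<Rightarrow> 'x) \<Rightarrow> bool" where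
  "eve_strategy G \<sigma> \<longleftrightarrow>
     (\<forall>h. fin_path G h \<and> last h \<in> eve G \<and> \<not> deadlock G (last h) \<longrightarrow> (last h, \<sigma> h) \<in> edges G)"

text \<open>Plays are maximal paths: infinite ones, or finite ones ending in a vertex without
  successors.\<close>

definition fin_play_from :: "'x game \<Rightarrow> ('x list \<Rightarrow> 'x) \<Rightarrow> 'x \<Rightarrow> 'x list \<Rightarrow> bool" where
  "fin_play_from G \<sigma> x h \<longleftrightarrow>
     fin_path G h \<and> hd h = x \<and> deadlock G (last h) \<and>
     (\<forall>i. Suc i < length h \<and> h ! i \<in> eve G \<longrightarrow> h ! Suc i = \<sigma> (take (Suc i) h))"

definition inf_play_from :: "'x game \<Rightarrow> ('x list \<Rightarrow> 'x) \<Rightarrow> 'x \<Rightarrow> (nat \<Rightarrow> 'x) \<Rightarrow> bool" where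
  "inf_play_from G \<sigma> x p \<longleftrightarrow>
     inf_path G p \<and> p 0 = x \<and>
     (\<forall>i. p i \<in> eve G \<longrightarrow> p (Suc i) = \<sigma> (map p [0..<Suc i]))"

definition eve_wins :: "'x game \<Rightarrow> 'x \<Rightarrow> bool" where
  "eve_wins G x \<longleftrightarrow>
     (\<exists>\<sigma>. eve_strategy G \<sigma> \<and>
       (\<forall>h. fin_play_from G \<sigma> x h \<longrightarrow> set h \<inter> targets G \<noteq> {}) \<and>
       (\<forall>p. inf_play_from G \<sigma> x p \<longrightarrow> range p \<inter> targets G \<noteq> {}))"


section \<open>The knowledge game\<close>

datatype ('v, 'a) kvertex = EveV 'v "nat set" | AdamV 'v "nat set" 'a

definition knowledge_game :: "('v, 'a) arena \<Rightarrow> 'v \<Rightarrow> ('v, 'a) kvertex game" where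
  "knowledge_game A t =
     \<lparr> eve = {EveV v K | v K. v \<in> verts A \<and> K \<subseteq> Npos},
       adam = {AdamV v K a | v K a. v \<in> verts A \<and> K \<subseteq> Npos \<and> a \<in> acts A},
       edges =
         {(EveV v K, AdamV v K a) | v K a. v \<in> verts A \<and> K \<subseteq> Npos \<and> a \<in> En A v} \<union>
         {(AdamV v K a, EveV v' (K \<inter> nabla A v a v')) | v K a v'.
            v \<in> verts A \<and> K \<subseteq> Npos \<and> a \<in> acts A \<and> v' \<in> verts A \<and> K \<inter> nabla A v a v' \<noteq> {}},
       targets = {EveV t K | K. K \<subseteq> Npos} \<rparr>"


section \<open>Coherent sets and antichains\<close>

definition coherent :: "('v, 'a) arena \<Rightarrow> nat set set \<Rightarrow> bool" where
  "coherent A \<K> \<longleftrightarrow>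
     \<K> \<subseteq> Pow Npos \<and> Npos \<in> \<K> \<and> {} \<in> \<K> \<and>
     (\<forall>v\<in>verts A. \<forall>a\<in>acts A. \<forall>v'\<in>verts A. nabla A v a v' \<in> \<K>) \<and>
     (\<forall>K\<in>\<K>. \<forall>K'\<in>\<K>. K \<union> K' \<in> \<K> \<and> K \<inter> K' \<in> \<K> \<and> K - K' \<in> \<K>)"

definition eve_verts :: "('v, 'a) arena \<Rightarrow> nat set set \<Rightarrow> ('v \<times> nat set) set" where
  "eve_verts A \<K> = verts A \<times> \<K>"

definition kle :: "'v \<times> nat set \<Rightarrow> 'v \<times> nat set \<Rightarrow> bool" (infix "\<preceq>" 50) where
  "x \<preceq> y \<longleftrightarrow> fst x = fst y \<and> snd x \<subseteq> snd y"

definition antichain :: "('v \<times> nat set) set \<Rightarrow> bool" where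
  "antichain L \<longleftrightarrow> (\<forall>x\<in>L. \<forall>y\<in>L. x \<preceq> y \<longrightarrow> x = y)"

definition Dom ::
  "('v, 'a) arena \<Rightarrow> nat set set \<Rightarrow> ('v \<times> nat set) set \<Rightarrow> ('v \<times> nat set) set" where
  "Dom A \<K> L = {x \<in> eve_verts A \<K>. \<exists>x'\<in>L. x \<preceq> x' \<and> x \<noteq> x'}"

definition maxl ::
  "('v, 'a) arena \<Rightarrow> nat set set \<Rightarrow> ('v \<times> nat set) set \<Rightarrow> ('v \<times> nat set) set" where
  "maxl A \<K> L = L - Dom A \<K> L"

definition down ::
  "('v, 'a) arena \<Rightarrow> nat set set \<Rightarrow> ('v \<times> nat set) set \<Rightarrow> ('v \<times> nat set) set" where
  "down A \<K> L = L \<union> Dom A \<K> L"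

definition ajoin ::
  "('v, 'a) arena \<Rightarrow> nat set set \<Rightarrow> ('v \<times> nat set) set \<Rightarrow> ('v \<times> nat set) set
     \<Rightarrow> ('v \<times> nat set) set" where
  "ajoin A \<K> L L' = maxl A \<K> (L \<union> L')"


section \<open>Predecessor operators and the sequences of antichains\<close>

definition KPred ::
  "('v, 'a) arena \<Rightarrow> nat set set \<Rightarrow> 'v \<Rightarrow> 'a \<Rightarrow> ('v \<times> nat set) set \<Rightarrow> nat set set" where
  "KPred A \<K> v a S = {K \<in> \<K>. \<forall>v'\<in>verts A. (v', K \<inter> nabla A v a v') \<in> S}"

definition Pred ::
  "('v, 'a) arena \<Rightarrow> nat set set \<Rightarrow> ('v \<times> nat set) set \<Rightarrow> ('v \<times> nat set) set" where
  "Pred A \<K> S = (\<Union>v\<in>verts A. \<Union>a\<in>En A v. {(v, K) | K. K \<in> KPred A \<K> v a S})"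

text \<open>For \<open>V' = {}\<close> the inner intersection is \<^term>\<open>UNIV\<close> rather than \<^term>\<open>Npos\<close>, which is
  immaterial because \<^const>\<open>nabla_set\<close> is contained in \<^term>\<open>Npos\<close>.\<close>

definition KPredAlt ::
  "('v, 'a) arena \<Rightarrow> 'v \<Rightarrow> 'a \<Rightarrow> ('v \<times> nat set) set \<Rightarrow> nat set set" where
  "KPredAlt A v a S =
     {(\<Union>V'\<in>Pow (verts A). nabla_set A v a V' \<inter> (\<Inter>v'\<in>V'. \<kappa> v')) | \<kappa>.
        \<forall>v'\<in>verts A. (v', \<kappa> v') \<in> S}"

definition PredAlt ::
  "('v, 'a) arena \<Rightarrow> ('v \<times> nat set) set \<Rightarrow> ('v \<times> nat set) set" where
  "PredAlt A S = (\<Union>v\<in>verts A. \<Union>a\<in>En A v. {(v, K) | K. K \<in> KPredAlt A v a S})"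

definition W0 :: "('v, 'a) arena \<Rightarrow> 'v \<Rightarrow> ('v \<times> nat set) set" where
  "W0 A t = {(t, Npos)} \<union> {(v, {}) | v. v \<in> verts A - {t}}"

primrec W_coh ::
  "('v, 'a) arena \<Rightarrow> 'v \<Rightarrow> nat set set \<Rightarrow> nat \<Rightarrow> ('v \<times> nat set) set" where
  "W_coh A t \<K> 0 = W0 A t"
| "W_coh A t \<K> (Suc i) =
     ajoin A \<K> (W_coh A t \<K> i) (Pred A \<K> (down A \<K> (W_coh A t \<K> i)))"

definition W :: "('v, 'a) arena \<Rightarrow> 'v \<Rightarrow> nat \<Rightarrow> ('v \<times> nat set) set" where
  "W A t = W_coh A t (Pow Npos)"

primrec W_alt :: "('v, 'a) arena \<Rightarrow> 'v \<Rightarrow> nat \<Rightarrow> ('v \<times> nat set) set" where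
  "W_alt A t 0 = W0 A t"
| "W_alt A t (Suc i) = ajoin A (Pow Npos) (W_alt A t i) (PredAlt A (W_alt A t i))"

definition eventually_constant :: "(nat \<Rightarrow> 'x) \<Rightarrow> bool" where
  "eventually_constant X \<longleftrightarrow> (\<exists>x. \<forall>\<^sub>F i in sequentially. X i = x)"

text \<open>Meaningful only for sequences satisfying \<^const>\<open>eventually_constant\<close>.\<close>

definition eventual_value :: "(nat \<Rightarrow> 'x) \<Rightarrow> 'x" where
  "eventual_value X = (THE x. \<forall>\<^sub>F i in sequentially. X i = x)"

end

theory Submission
  imports Defs
begin

text \<open>
  \<^const>\<open>PredAlt\<close> of an antichain and \<^const>\<open>Pred\<close> of its downward closure have the same
  maximal elements: a choice of sets \<open>\<kappa> v'\<close> yields the largest \<open>K\<close> with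
  \<open>K \<inter> \<nabla>(v, a, v') \<subseteq> \<kappa> v'\<close> for all \<open>v'\<close>, and this \<open>K\<close> is a finite Boolean combination of the
  \<open>\<nabla>\<close> and the \<open>\<kappa> v'\<close>, hence lies in every coherent set. So all the sequences agree step by step,
  and they stabilise because the Boolean algebra generated by the \<open>\<nabla>\<close> is finite. The downward closure of
  the \<open>i\<close>-th antichain is the set of positions from which Eve reaches the target within \<open>i\<close> rounds,
  except that empty knowledge counts as won.
\<close>

section \<open>Reachability games\<close>

text \<open>Playing rank-decreasing moves keeps a play inside \<open>R\<close> until it meets a
  target. Before that, every vertex has a successor and every step lowers \<open>r\<close>, so a
  play avoiding the targets can neither stop nor go on forever.\<close>

lemma eve_wins_by_rank:
  fixes r :: "'x \<Rightarrow> nat"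
  assumes eve: "\<And>x. x \<in> R \<Longrightarrow> x \<in> eve G \<Longrightarrow> x \<notin> targets G \<Longrightarrow>
      \<exists>y. (x, y) \<in> edges G \<and> y \<in> R \<and> r y < r x"
    and other: "\<And>x. x \<in> R \<Longrightarrow> x \<notin> eve G \<Longrightarrow> x \<notin> targets G \<Longrightarrow>
      \<not> deadlock G x \<and> (\<forall>y. (x, y) \<in> edges G \<longrightarrow> y \<in> R \<and> r y < r x)"
    and "x \<in> R"
  shows "eve_wins G x"
proof -
  \<comment> \<open>Outside \<open>R - targets G\<close> the choice is an arbitrary successor:
    \<open>eve_strategy\<close> demands a legal move after every history, not only after those
    reached from \<open>x\<close>.\<close>
  define f where "f x = (if x \<in> R - targets G
      then SOME y. (x, y) \<in> edges G \<and> y \<in> R \<and> r y < r x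
      else SOME y. (x, y) \<in> edges G)" for x
  have f_good: "(z, f z) \<in> edges G \<and> f z \<in> R \<and> r (f z) < r z"
    if "z \<in> R" "z \<in> eve G" "z \<notin> targets G" for z
    using someI_ex[OF eve[OF that]] that by (simp add: f_def)
  have f_edge: "(z, f z) \<in> edges G" if "z \<in> eve G" "\<not> deadlock G z" for z
  proof (cases "z \<in> R - targets G")
    case True
    then show ?thesis using f_good that by blast
  next
    case False
    moreover have "\<exists>y. (z, y) \<in> edges G" using that by (simp add: deadlock_def)
    ultimately show ?thesis by (simp only: f_def if_False) (rule someI_ex)
  qed
  have step: "y \<in> R \<and> r y < r z"
    if "z \<in> R" "z \<notin> targets G" "(z, y) \<in> edges G" "z \<in> eve G \<Longrightarrow> y = f z" for z y
    using f_good[of z] other[of z] that by (cases "z \<in> eve G") metis+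
  let ?\<sigma> = "\<lambda>h. f (last h)"
  have "eve_strategy G ?\<sigma>"
    using f_edge by (simp add: eve_strategy_def)
  moreover have "set h \<inter> targets G \<noteq> {}" if play: "fin_play_from G ?\<sigma> x h" for h
  proof
    assume avoid: "set h \<inter> targets G = {}"
    have h: "h \<noteq> []" "hd h = x" "deadlock G (last h)"
      and edge: "\<And>i. Suc i < length h \<Longrightarrow> (h ! i, h ! Suc i) \<in> edges G"
      and cons: "\<And>i. Suc i < length h \<Longrightarrow> h ! i \<in> eve G \<Longrightarrow> h ! Suc i = f (last (take (Suc i) h))"
      using play by (auto simp: fin_play_from_def fin_path_def)
    have "h ! i \<in> R" if "i < length h" for i
      using that
    proof (induction i)
      case 0
      then show ?case using h \<open>x \<in> R\<close> by (simp add: hd_conv_nth)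
    next
      case (Suc i)
      then have "h ! i \<in> R" "h ! i \<in> set h" by simp_all
      then have "h ! i \<in> R" "h ! i \<notin> targets G" using avoid by blast+
      moreover have "h ! Suc i = f (h ! i)" if "h ! i \<in> eve G"
        using cons[of i] that Suc.prems by (simp add: take_Suc_conv_app_nth)
      ultimately show ?case using step[of "h ! i" "h ! Suc i"] edge[OF Suc.prems] by blast
    qed
    then have "last h \<in> R" using h by (simp add: last_conv_nth)
    moreover have "last h \<notin> targets G" using h avoid last_in_set by blast
    ultimately show False using h eve other unfolding deadlock_def by blast
  qed
  moreover have "range p \<inter> targets G \<noteq> {}" if play: "inf_play_from G ?\<sigma> x p" for p
  proof
    assume avoid: "range p \<inter> targets G = {}"
    have edge: "(p i, p (Suc i)) \<in> edges G"
      and cons: "p i \<in> eve G \<Longrightarrow> p (Suc i) = f (p i)" for i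
      using play by (auto simp: inf_play_from_def inf_path_def)
    \<comment> \<open>The rank drops by at least one per step, so index \<open>Suc (r (p 0))\<close>
      gives a contradiction.\<close>
    have "p i \<in> R \<and> r (p i) + i \<le> r (p 0)" for i
    proof (induction i)
      case 0
      then show ?case using play \<open>x \<in> R\<close> by (simp add: inf_play_from_def)
    next
      case (Suc i)
      have "p i \<notin> targets G" using avoid by auto
      then show ?case using step[of "p i" "p (Suc i)"] edge[of i] cons[of i] Suc by auto
    qed
    from this[of "Suc (r (p 0))"] show False by simp
  qed
  ultimately show ?thesis unfolding eve_wins_def by blast
qed

text \<open>Eve cannot enter \<open>R\<close> by her own move from outside, and Adam can always stay
  outside unless he is stuck. Against any strategy of Eve this yields a play avoiding
  \<open>R\<close>, hence all targets. Stuck Adam vertices need not belong to \<open>R\<close>: a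
  play that ends there without a target is already lost for Eve.\<close>

lemma eve_wins_imp_in_closed:
  assumes edges: "edges G \<subseteq> UNIV \<times> (eve G \<union> adam G)"
    and targets: "targets G \<subseteq> R"
    and eve: "\<And>x y. x \<in> eve G \<Longrightarrow> (x, y) \<in> edges G \<Longrightarrow> y \<in> R \<Longrightarrow> x \<in> R"
    and adam: "\<And>x. x \<in> adam G \<Longrightarrow> x \<notin> eve G \<Longrightarrow> \<not> deadlock G x \<Longrightarrow>
      (\<And>y. (x, y) \<in> edges G \<Longrightarrow> y \<in> R) \<Longrightarrow> x \<in> R"
    and x: "x \<in> eve G \<union> adam G"
    and win: "eve_wins G x"
  shows "x \<in> R"
proof (rule ccontr)
  assume "x \<notin> R"
  obtain \<sigma> where strat: "eve_strategy G \<sigma>"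
    and fin: "\<And>h. fin_play_from G \<sigma> x h \<Longrightarrow> set h \<inter> targets G \<noteq> {}"
    and inf: "\<And>p. inf_play_from G \<sigma> x p \<Longrightarrow> range p \<inter> targets G \<noteq> {}"
    using win unfolding eve_wins_def by blast
  define nxt where "nxt h = (if last h \<in> eve G then \<sigma> h
      else SOME y. (last h, y) \<in> edges G \<and> y \<notin> R)" for h
  \<comment> \<open>The histories from \<open>x\<close> that follow \<open>\<sigma>\<close> and have
    stayed outside \<open>R\<close> so far.\<close>
  define good where "good h \<longleftrightarrow> fin_path G h \<and> hd h = x \<and> set h \<inter> R = {} \<and>
      (\<forall>i. Suc i < length h \<and> h ! i \<in> eve G \<longrightarrow> h ! Suc i = \<sigma> (take (Suc i) h))" for h
  \<comment> \<open>If the last vertex were a deadlock, \<open>h\<close> would be a complete play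
    missing every target, contradicting that \<open>\<sigma>\<close> wins.\<close>
  have live: "\<not> deadlock G (last h)" if "good h" for h
    using that fin[of h] targets by (auto simp: good_def fin_play_from_def)
  have nxt: "(last h, nxt h) \<in> edges G \<and> nxt h \<notin> R" if "good h" for h
  proof -
    have h: "fin_path G h" "last h \<in> eve G \<union> adam G" "last h \<notin> R"
      using that last_in_set[of h] unfolding good_def fin_path_def by blast+
    show ?thesis
    proof (cases "last h \<in> eve G")
      case True
      then have "(last h, \<sigma> h) \<in> edges G"
        using strat h live[OF that] by (auto simp: eve_strategy_def)
      with True h eve show ?thesis by (auto simp: nxt_def)
    next
      case False
      then have "\<exists>y. (last h, y) \<in> edges G \<and> y \<notin> R"
        using adam h live[OF that] by blast
      from someI_ex[OF this] False show ?thesis by (simp add: nxt_def)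
    qed
  qed
  have extend: "good (h @ [nxt h])" if "good h" for h
  proof -
    have h: "h \<noteq> []" using that by (auto simp: good_def fin_path_def)
    have e: "(last h, nxt h) \<in> edges G" "nxt h \<notin> R" using nxt[OF that] by auto
    have pos: "Suc i < length h \<or> Suc i = length h" if "Suc i < length (h @ [nxt h])" for i
      using that by auto
    have "fin_path G (h @ [nxt h])"
      unfolding fin_path_def
    proof (intro conjI allI impI)
      show "set (h @ [nxt h]) \<subseteq> eve G \<union> adam G"
        using \<open>good h\<close> e edges by (auto simp: good_def fin_path_def)
    next
      fix i assume "Suc i < length (h @ [nxt h])"
      from pos[OF this] show "((h @ [nxt h]) ! i, (h @ [nxt h]) ! Suc i) \<in> edges G"
      proof
        assume "Suc i < length h"
        then show ?thesis using \<open>good h\<close> by (auto simp: good_def fin_path_def nth_append)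
      next
        assume i: "Suc i = length h"
        then have "h ! i = last h" using h by (simp add: last_conv_nth flip: i)
        with i e show ?thesis by (auto simp: nth_append)
      qed
    qed simp
    moreover have "(h @ [nxt h]) ! Suc i = \<sigma> (take (Suc i) (h @ [nxt h]))"
      if "Suc i < length (h @ [nxt h])" "(h @ [nxt h]) ! i \<in> eve G" for i
      using pos[OF that(1)]
    proof
      assume "Suc i < length h"
      then show ?thesis using \<open>good h\<close> that by (auto simp: good_def nth_append)
    next
      assume i: "Suc i = length h"
      then have "h ! i = last h" using h by (simp add: last_conv_nth flip: i)
      with i that show ?thesis by (auto simp: nth_append nxt_def)
    qed
    ultimately show ?thesis using \<open>good h\<close> e h by (auto simp: good_def)
  qed
  define hist where "hist n = ((\<lambda>h. h @ [nxt h]) ^^ n) [x]" for n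
  have hist_simps: "hist 0 = [x]" "hist (Suc n) = hist n @ [nxt (hist n)]" for n
    by (simp_all add: hist_def)
  have good: "good (hist n)" for n
  proof (induction n)
    case 0
    show ?case using x \<open>x \<notin> R\<close> by (auto simp: hist_simps good_def fin_path_def)
  next
    case (Suc n)
    then show ?case using extend by (simp add: hist_simps)
  qed
  define p where "p n = last (hist n)" for n
  have p_Suc: "p (Suc n) = nxt (hist n)" for n by (simp add: p_def hist_simps)
  \<comment> \<open>The iterated extensions are the prefixes of one infinite play, in the form in
    which \<open>inf_play_from\<close> feeds prefixes to the strategy.\<close>
  have hist_p: "hist n = map p [0..<Suc n]" for n
    by (induction n) (auto simp: hist_simps p_def)
  have "(p n, p (Suc n)) \<in> edges G" for n
    using nxt[OF good[of n]] unfolding p_Suc by (simp add: p_def)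
  moreover have p_set: "p n \<in> set (hist n)" for n
    by (simp add: hist_p)
  moreover have "p n \<in> eve G \<union> adam G" and p_notin: "p n \<notin> R" for n
    using good[of n] p_set[of n] unfolding good_def fin_path_def by blast+
  moreover have "p (Suc n) = \<sigma> (map p [0..<Suc n])" if "p n \<in> eve G" for n
    using that unfolding hist_p[symmetric] p_Suc by (simp add: nxt_def p_def)
  moreover have "p 0 = x" by (simp add: p_def hist_simps)
  ultimately have "inf_play_from G \<sigma> x p"
    unfolding inf_play_from_def inf_path_def by blast
  from inf[OF this] targets p_notin show False by auto
qed


section \<open>Antichains\<close>

lemma kle_refl [simp]: "x \<preceq> x"
  by (simp add: kle_def)

lemma kle_trans: "x \<preceq> y \<Longrightarrow> y \<preceq> z \<Longrightarrow> x \<preceq> z"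
  by (auto simp: kle_def)

lemma kle_antisym: "x \<preceq> y \<Longrightarrow> y \<preceq> x \<Longrightarrow> x = y"
  by (auto simp: kle_def prod_eq_iff)

lemma kle_Pair [simp]: "(v, K) \<preceq> (v', K') \<longleftrightarrow> v = v' \<and> K \<subseteq> K'"
  by (simp add: kle_def)

lemma down_eq:
  assumes "L \<subseteq> eve_verts A \<K>"
  shows "down A \<K> L = {x \<in> eve_verts A \<K>. \<exists>y\<in>L. x \<preceq> y}"
  using assms kle_refl unfolding down_def Dom_def by blast

lemma maxl_eq:
  assumes "L \<subseteq> eve_verts A \<K>"
  shows "maxl A \<K> L = {x \<in> L. \<forall>y\<in>L. x \<preceq> y \<longrightarrow> x = y}"
  using assms by (auto simp: maxl_def Dom_def)

lemma antichain_maxl: "L \<subseteq> eve_verts A \<K> \<Longrightarrow> antichain (maxl A \<K> L)"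
  by (simp add: maxl_eq antichain_def)

text \<open>A maximal element of \<open>Y\<close> lies below some element of \<open>X\<close>, hence
  equals it. The two ambient families may differ, since \<open>maxl\<close> does not depend on the
  family once it contains all the sets involved; this is what makes antichains computed in different
  coherent sets comparable.\<close>

lemma maxl_cofinal:
  assumes "X \<subseteq> Y" "Y \<subseteq> eve_verts A \<K>" "X \<subseteq> eve_verts A \<K>'"
    and cof: "\<And>y. y \<in> Y \<Longrightarrow> \<exists>x\<in>X. y \<preceq> x"
  shows "maxl A \<K> Y = maxl A \<K>' X"
  unfolding maxl_eq[OF assms(2)] maxl_eq[OF assms(3)]
proof (intro equalityI subsetI)
  fix x assume x: "x \<in> {x \<in> Y. \<forall>y\<in>Y. x \<preceq> y \<longrightarrow> x = y}"
  then obtain z where "z \<in> X" "x \<preceq> z" using cof by blast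
  then have "x \<in> X" using x \<open>X \<subseteq> Y\<close> by auto
  then show "x \<in> {x \<in> X. \<forall>y\<in>X. x \<preceq> y \<longrightarrow> x = y}"
    using x \<open>X \<subseteq> Y\<close> by auto
next
  fix x assume x: "x \<in> {x \<in> X. \<forall>y\<in>X. x \<preceq> y \<longrightarrow> x = y}"
  have "x = y" if "y \<in> Y" "x \<preceq> y" for y
  proof -
    obtain z where z: "z \<in> X" "y \<preceq> z" using cof \<open>y \<in> Y\<close> by blast
    then have "x = z" using x kle_trans[OF that(2)] by blast
    then show ?thesis using z kle_antisym[OF that(2)] by simp
  qed
  moreover have "x \<in> Y" using x \<open>X \<subseteq> Y\<close> by auto
  ultimately show "x \<in> {x \<in> Y. \<forall>y\<in>Y. x \<preceq> y \<longrightarrow> x = y}" by simp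
qed

text \<open>Allows an antichain to be recovered from its downward closure, so that stabilisation can
  be proved for the closures, which grow monotonically.\<close>

lemma maxl_down_antichain:
  assumes "antichain L" "L \<subseteq> eve_verts A \<K>"
  shows "maxl A \<K> (down A \<K> L) = L"
proof -
  have "maxl A \<K> (down A \<K> L) = maxl A \<K> L"
    using assms kle_refl by (intro maxl_cofinal) (unfold down_eq[OF assms(2)], blast+)
  also have "\<dots> = L" using assms by (auto simp: maxl_eq antichain_def)
  finally show ?thesis .
qed

lemma finite_below_maximal:
  assumes "finite L" "x \<in> L"
  shows "\<exists>m\<in>L. x \<preceq> m \<and> (\<forall>y\<in>L. m \<preceq> y \<longrightarrow> m = y)"
  using assms
proof (induction "card {y \<in> L. x \<preceq> y}" arbitrary: x rule: less_induct)
  case less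
  show ?case
  proof (cases "\<forall>y\<in>L. x \<preceq> y \<longrightarrow> x = y")
    case True
    then show ?thesis using less.prems kle_refl by blast
  next
    case False
    then obtain y where y: "y \<in> L" "x \<preceq> y" "x \<noteq> y" by blast
    have "{z \<in> L. y \<preceq> z} \<subseteq> {z \<in> L. x \<preceq> z}"
      using y kle_trans by blast
    moreover have "\<not> y \<preceq> x" using y kle_antisym by blast
    ultimately have "{z \<in> L. y \<preceq> z} \<subset> {z \<in> L. x \<preceq> z}"
      using less.prems kle_refl by blast
    then have "card {z \<in> L. y \<preceq> z} < card {z \<in> L. x \<preceq> z}"
      using less.prems by (intro psubset_card_mono) auto
    from less.hyps[OF this less.prems(1) y(1)] show ?thesis using y kle_trans by blast
  qed
qed

text \<open>Finiteness puts every element of \<open>L\<close> below a maximal one, so pruning to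
  \<open>maxl\<close> loses nothing from the closure.\<close>

lemma down_maxl:
  assumes "finite L" "L \<subseteq> eve_verts A \<K>"
  shows "down A \<K> (maxl A \<K> L) = down A \<K> L"
proof -
  have "maxl A \<K> L \<subseteq> L" by (auto simp: maxl_def)
  moreover have "\<exists>m\<in>maxl A \<K> L. x \<preceq> m" if "x \<in> L" for x
    using finite_below_maximal[OF assms(1) that] by (auto simp: maxl_eq[OF assms(2)])
  ultimately show ?thesis
    using assms kle_trans by (subst (1 2) down_eq) blast+
qed


section \<open>Coherent sets\<close>

lemma coherent_Pow: "coherent A (Pow Npos)"
  by (auto simp: coherent_def nabla_def)

text \<open>The finite algebra of sets that do not separate parameters with the same behaviour.\<close>

lemma finite_coherent_exists:
  assumes "param_arena A"
  shows "\<exists>\<K>. finite \<K> \<and> coherent A \<K>"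
proof -
  define I where "I = verts A \<times> acts A \<times> verts A"
  \<comment> \<open>The behaviour of the parameter \<open>k\<close>: all transitions it permits.
    There are finitely many behaviours, and \<open>\<K>\<close> consists of the unions of their
    classes.\<close>
  define sig where "sig k = {(v, a, v') \<in> I. k \<in> nabla A v a v'}" for k
  define \<K> where "\<K> = (\<lambda>S. {k \<in> Npos. sig k \<in> S}) ` Pow (Pow I)"
  have "finite \<K>" using assms by (simp add: \<K>_def I_def param_arena_def)
  have sig: "sig k \<in> Pow I" for k by (auto simp: sig_def)
  have inK: "X \<in> \<K> \<longleftrightarrow> X \<subseteq> Npos \<and>
      (\<forall>k\<in>Npos. \<forall>l\<in>Npos. sig k = sig l \<longrightarrow> k \<in> X \<longrightarrow> l \<in> X)" for X
  proof
    assume "X \<in> \<K>"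
    then show "X \<subseteq> Npos \<and> (\<forall>k\<in>Npos. \<forall>l\<in>Npos. sig k = sig l \<longrightarrow> k \<in> X \<longrightarrow> l \<in> X)"
      by (auto simp: \<K>_def)
  next
    assume X: "X \<subseteq> Npos \<and> (\<forall>k\<in>Npos. \<forall>l\<in>Npos. sig k = sig l \<longrightarrow> k \<in> X \<longrightarrow> l \<in> X)"
    then have "X = {k \<in> Npos. sig k \<in> sig ` X}" by auto
    then show "X \<in> \<K>" unfolding \<K>_def using sig by blast
  qed
  have "nabla A v a v' \<in> \<K>" if "v \<in> verts A" "a \<in> acts A" "v' \<in> verts A" for v a v'
  proof -
    have "k \<in> nabla A v a v' \<longleftrightarrow> (v, a, v') \<in> sig k" for k
      using that by (simp add: sig_def I_def)
    then show ?thesis unfolding inK by (auto simp: nabla_def)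
  qed
  moreover have "X \<union> Y \<in> \<K> \<and> X \<inter> Y \<in> \<K> \<and> X - Y \<in> \<K>" if "X \<in> \<K>" "Y \<in> \<K>" for X Y
  proof -
    have sym: "k \<in> Z \<longleftrightarrow> l \<in> Z"
      if "Z \<in> \<K>" "k \<in> Npos" "l \<in> Npos" "sig k = sig l" for Z k l
      using that inK[of Z] by metis
    show ?thesis
      using that sym[OF that(1)] sym[OF that(2)] unfolding inK[of "X \<union> Y"] inK[of "X \<inter> Y"] inK[of "X - Y"]
      using inK[of X] inK[of Y] by blast
  qed
  moreover have "\<K> \<subseteq> Pow Npos" "Npos \<in> \<K>" "{} \<in> \<K>"
    by (auto simp: inK)
  ultimately have "coherent A \<K>" by (simp add: coherent_def)
  with \<open>finite \<K>\<close> show ?thesis by blast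
qed


section \<open>The predecessor operators\<close>

text \<open>The largest \<open>K\<close> with
  \<open>K \<inter> nabla A v a v' \<subseteq> \<kappa> v'\<close> for all \<open>v'\<close> in
  \<open>F\<close>. The vertex set is an argument so that membership in a coherent set can be shown
  by induction on it.\<close>

definition safe_params :: "('v, 'a) arena \<Rightarrow> 'v \<Rightarrow> 'a \<Rightarrow> ('v \<Rightarrow> nat set) \<Rightarrow> 'v set \<Rightarrow> nat set" where
  "safe_params A v a \<kappa> F = {k \<in> Npos. \<forall>v'\<in>F. k \<in> nabla A v a v' \<longrightarrow> k \<in> \<kappa> v'}"

text \<open>The sets \<open>nabla_set A v a V'\<close> with \<open>V' \<subseteq> verts A\<close>
  partition \<open>Npos\<close> according to the exact successor set of a parameter, so the union
  over \<open>V'\<close> tests each parameter against its own successors only.\<close>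

lemma KPredAlt_eq:
  "KPredAlt A v a S = {safe_params A v a \<kappa> (verts A) | \<kappa>. \<forall>v'\<in>verts A. (v', \<kappa> v') \<in> S}"
proof -
  have "(\<Union>V'\<in>Pow (verts A). nabla_set A v a V' \<inter> (\<Inter>v'\<in>V'. \<kappa> v')) = safe_params A v a \<kappa> (verts A)"
    (is "?L = ?R") for \<kappa>
  proof (intro equalityI subsetI)
    fix k assume "k \<in> ?L"
    then show "k \<in> ?R" by (auto simp: nabla_set_def safe_params_def)
  next
    fix k assume k: "k \<in> ?R"
    let ?V = "{v' \<in> verts A. k \<in> nabla A v a v'}"
    have "k \<in> nabla_set A v a ?V \<inter> (\<Inter>v'\<in>?V. \<kappa> v')"
      using k by (auto simp: nabla_set_def safe_params_def)
    then show "k \<in> ?L" by (intro UN_I[of ?V]) auto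
  qed
  then show ?thesis by (simp add: KPredAlt_def)
qed

text \<open>Each further vertex \<open>u\<close> removes just the parameters in
  \<open>nabla A v a u - \<kappa> u\<close>, a set difference within \<open>\<K>\<close>.\<close>

lemma safe_params_coherent:
  assumes "coherent A \<K>" "finite F" "F \<subseteq> verts A" "v \<in> verts A" "a \<in> acts A"
    and "\<And>v'. v' \<in> F \<Longrightarrow> \<kappa> v' \<in> \<K>"
  shows "safe_params A v a \<kappa> F \<in> \<K>"
  using assms(2,3,6)
proof (induction F)
  case empty
  then show ?case using assms(1) by (simp add: safe_params_def coherent_def atLeast_def)
next
  case (insert u F)
  have diff: "X - Y \<in> \<K>" if "X \<in> \<K>" "Y \<in> \<K>" for X Y
    using assms(1) that by (simp add: coherent_def)
  have "safe_params A v a \<kappa> (insert u F) = safe_params A v a \<kappa> F - (nabla A v a u - \<kappa> u)"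
    by (auto simp: safe_params_def)
  moreover have "nabla A v a u \<in> \<K>" using assms insert.prems by (auto simp: coherent_def)
  ultimately show ?case using insert by (auto intro!: diff)
qed

lemma En_acts: "a \<in> En A v \<Longrightarrow> a \<in> acts A"
  by (simp add: En_def)

lemma Pred_coherent: "Pred A \<K> S \<subseteq> eve_verts A \<K>"
  by (auto simp: Pred_def KPred_def eve_verts_def)

context
  fixes A :: "('v, 'a) arena"
  assumes arena: "param_arena A"
begin

lemma PredAlt_coherent:
  assumes "coherent A \<K>" "L \<subseteq> eve_verts A \<K>"
  shows "PredAlt A L \<subseteq> eve_verts A \<K>"
proof -
  have "safe_params A v a \<kappa> (verts A) \<in> \<K>"
    if "v \<in> verts A" "a \<in> En A v" "\<forall>v'\<in>verts A. (v', \<kappa> v') \<in> L" for v a \<kappa>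
    using assms that arena
    by (intro safe_params_coherent) (auto simp: param_arena_def eve_verts_def En_acts)
  then show ?thesis by (auto simp: PredAlt_def KPredAlt_eq eve_verts_def)
qed

text \<open>The set built from a choice \<open>\<kappa>\<close> meets each
  \<open>nabla A v a v'\<close> inside \<open>\<kappa> v'\<close>, and so lands in the downward
  closure.\<close>

lemma PredAlt_subset_Pred_down:
  assumes "coherent A \<K>" "L \<subseteq> eve_verts A \<K>"
  shows "PredAlt A L \<subseteq> Pred A \<K> (down A \<K> L)"
proof
  fix x assume x: "x \<in> PredAlt A L"
  then obtain v a \<kappa> where v: "v \<in> verts A" "a \<in> En A v" "\<forall>v'\<in>verts A. (v', \<kappa> v') \<in> L"
    and x_eq: "x = (v, safe_params A v a \<kappa> (verts A))"
    unfolding PredAlt_def KPredAlt_eq by blast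
  let ?M = "safe_params A v a \<kappa> (verts A)"
  have M: "?M \<in> \<K>" using PredAlt_coherent[OF assms] x x_eq by (auto simp: eve_verts_def)
  have "(v', ?M \<inter> nabla A v a v') \<in> down A \<K> L" if "v' \<in> verts A" for v'
  proof -
    have "?M \<inter> nabla A v a v' \<in> \<K>"
      using M assms(1) v that by (auto simp: coherent_def En_acts)
    moreover have "?M \<inter> nabla A v a v' \<subseteq> \<kappa> v'" using that by (auto simp: safe_params_def)
    ultimately show ?thesis
      using v that by (auto simp: down_eq[OF assms(2)] eve_verts_def intro!: bexI[of _ "(v', \<kappa> v')"])
  qed
  then show "x \<in> Pred A \<K> (down A \<K> L)"
    using v M x_eq by (auto simp: Pred_def KPred_def)
qed

text \<open>Choosing for each successor an element of \<open>L\<close> above it gives a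
  \<open>\<kappa>\<close>; the given \<open>K\<close> then lies in the largest set safe for this
  \<open>\<kappa>\<close>.\<close>

lemma Pred_down_below_PredAlt:
  assumes "coherent A \<K>" "L \<subseteq> eve_verts A \<K>" "x \<in> Pred A \<K> (down A \<K> L)"
  shows "\<exists>y\<in>PredAlt A L. x \<preceq> y"
proof -
  obtain v a K where v: "v \<in> verts A" "a \<in> En A v" "K \<in> \<K>" and x: "x = (v, K)"
    and K: "\<And>v'. v' \<in> verts A \<Longrightarrow> (v', K \<inter> nabla A v a v') \<in> down A \<K> L"
    using assms(3) by (auto simp: Pred_def KPred_def)
  have "\<forall>v'\<in>verts A. \<exists>K'. (v', K') \<in> L \<and> K \<inter> nabla A v a v' \<subseteq> K'"
    using K by (fastforce simp: down_eq[OF assms(2)])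
  then obtain \<kappa> where \<kappa>: "\<And>v'. v' \<in> verts A \<Longrightarrow> (v', \<kappa> v') \<in> L \<and> K \<inter> nabla A v a v' \<subseteq> \<kappa> v'"
    by metis
  have "K \<subseteq> Npos" using v assms(1) by (auto simp: coherent_def)
  then have "K \<subseteq> safe_params A v a \<kappa> (verts A)" using \<kappa> by (auto simp: safe_params_def)
  moreover have "(v, safe_params A v a \<kappa> (verts A)) \<in> PredAlt A L"
    using v \<kappa> unfolding PredAlt_def KPredAlt_eq by blast
  ultimately show ?thesis unfolding x by (intro bexI[of _ "(v, safe_params A v a \<kappa> (verts A))"]) simp_all
qed

lemma Pred_down_cofinal:
  assumes "coherent A \<K>" "L \<subseteq> eve_verts A \<K>" "x \<in> L \<union> Pred A \<K> (down A \<K> L)"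
  shows "\<exists>y\<in>L \<union> PredAlt A L. x \<preceq> y"
  using assms Pred_down_below_PredAlt kle_refl by blast

end

(* Keeps the simplifier from turning Npos into {Suc 0..}, which facts about Npos do not match. *)
declare One_nat_def [simp del]

section \<open>Stepwise agreement and finiteness of the antichain sequences\<close>

context
  fixes A :: "('v, 'a) arena" and t :: 'v
  assumes arena: "param_arena A" and target: "t \<in> verts A"
begin

text \<open>\<open>PredAlt\<close> does not refer to a coherent set and \<open>maxl\<close> only
  deletes elements, so the one sequence lives in every coherent set at once, in particular in a
  finite one.\<close>

lemma W_alt_coherent:
  assumes "coherent A \<K>"
  shows "W_alt A t i \<subseteq> eve_verts A \<K>"
proof (induction i)
  case 0
  then show ?case using assms target by (auto simp: W0_def eve_verts_def coherent_def)
next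
  case (Suc i)
  then show ?case
    using PredAlt_coherent[OF arena assms Suc] by (auto simp: ajoin_def maxl_def)
qed

lemma W_alt_Pow: "W_alt A t i \<subseteq> eve_verts A (Pow Npos)"
  by (rule W_alt_coherent[OF coherent_Pow])

lemma W_alt_step_Pow: "W_alt A t i \<union> PredAlt A (W_alt A t i) \<subseteq> eve_verts A (Pow Npos)"
  using PredAlt_coherent[OF arena coherent_Pow] W_alt_Pow by simp

text \<open>At each step the alternative predecessors form a cofinal subset of the ordinary ones, so
  \<open>maxl_cofinal\<close> identifies the maximal elements.\<close>

lemma W_coh_eq_W_alt:
  assumes "coherent A \<K>"
  shows "W_coh A t \<K> i = W_alt A t i"
proof (induction i)
  case (Suc i)
  let ?L = "W_alt A t i"
  have L: "?L \<subseteq> eve_verts A \<K>" by (rule W_alt_coherent[OF assms])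
  have "maxl A \<K> (?L \<union> Pred A \<K> (down A \<K> ?L)) = maxl A (Pow Npos) (?L \<union> PredAlt A ?L)"
    using PredAlt_subset_Pred_down[OF arena assms L] Pred_coherent[of A \<K>] L
      W_alt_step_Pow Pred_down_cofinal[OF arena assms L]
    by (intro maxl_cofinal) auto
  then show ?case using Suc by (simp add: ajoin_def)
qed simp

lemma antichain_W_alt: "antichain (W_alt A t i)"
proof (cases i)
  case 0
  then show ?thesis by (auto simp: antichain_def W0_def)
next
  case (Suc j)
  then show ?thesis using antichain_maxl[OF W_alt_step_Pow] by (simp add: ajoin_def)
qed

lemma finite_W_alt_step: "finite (W_alt A t i \<union> PredAlt A (W_alt A t i))"
proof -
  obtain \<K> where \<K>: "finite \<K>" "coherent A \<K>" using finite_coherent_exists[OF arena] by blast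
  have "W_alt A t i \<union> PredAlt A (W_alt A t i) \<subseteq> eve_verts A \<K>"
    using PredAlt_coherent[OF arena \<K>(2)] W_alt_coherent[OF \<K>(2)] by simp
  moreover have "finite (eve_verts A \<K>)"
    using \<K> arena by (simp add: eve_verts_def param_arena_def)
  ultimately show ?thesis by (rule finite_subset)
qed


section \<open>Positions won within a bounded number of rounds\<close>

text \<open>Empty knowledge counts as won from the start because \<open>KPred\<close> also tests the
  pairs \<open>(v', {})\<close>, although Adam has no move leading to them.\<close>

primrec win_within :: "nat \<Rightarrow> ('v \<times> nat set) set" where
  "win_within 0 = {(v, K). v \<in> verts A \<and> K \<subseteq> Npos \<and> (v = t \<or> K = {})}"
| "win_within (Suc i) = win_within i \<union> Pred A (Pow Npos) (win_within i)"

text \<open>Pruning and replacing \<open>Pred\<close> by \<open>PredAlt\<close> both leave the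
  downward closure unchanged, provided that the ordinary predecessors are themselves downward
  closed.\<close>

lemma down_W_alt: "down A (Pow Npos) (W_alt A t i) = win_within i"
proof (induction i)
  case 0
  have "W0 A t \<subseteq> eve_verts A (Pow Npos)" using W_alt_Pow[of 0] by simp
  then show ?case using target by (fastforce simp: down_eq W0_def eve_verts_def)
next
  case (Suc i)
  let ?L = "W_alt A t i" and ?P = "Pow Npos"
  let ?Q = "Pred A ?P (down A ?P ?L)"
  have "down A ?P (W_alt A t (Suc i)) = down A ?P (?L \<union> PredAlt A ?L)"
    using down_maxl[OF finite_W_alt_step W_alt_step_Pow] by (simp add: ajoin_def)
  also have "\<dots> = down A ?P ?L \<union> ?Q"
  proof
    show "down A ?P ?L \<union> ?Q \<subseteq> down A ?P (?L \<union> PredAlt A ?L)"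
    proof (rule Un_least)
      show "down A ?P ?L \<subseteq> down A ?P (?L \<union> PredAlt A ?L)"
        unfolding down_eq[OF W_alt_step_Pow] down_eq[OF W_alt_Pow] by blast
      show "?Q \<subseteq> down A ?P (?L \<union> PredAlt A ?L)"
        using Pred_down_below_PredAlt[OF arena coherent_Pow W_alt_Pow] Pred_coherent
        unfolding down_eq[OF W_alt_step_Pow] by blast
    qed
    show "down A ?P (?L \<union> PredAlt A ?L) \<subseteq> down A ?P ?L \<union> ?Q"
    proof
      fix x assume x: "x \<in> down A ?P (?L \<union> PredAlt A ?L)"
      then obtain y where xy: "x \<in> eve_verts A ?P" "x \<preceq> y" "y \<in> ?L \<union> PredAlt A ?L"
        by (auto simp: down_eq[OF W_alt_step_Pow])
      show "x \<in> down A ?P ?L \<union> ?Q"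
      proof (cases "y \<in> ?L")
        case True
        then show ?thesis using xy by (auto simp: down_eq[OF W_alt_Pow])
      next
        case False
        then have "y \<in> ?Q"
          using xy PredAlt_subset_Pred_down[OF arena coherent_Pow W_alt_Pow] by blast
        then obtain v a K where v: "v \<in> verts A" "a \<in> En A v" and y: "y = (v, K)"
          and K: "\<And>v'. v' \<in> verts A \<Longrightarrow> (v', K \<inter> nabla A v a v') \<in> down A ?P ?L"
          by (auto simp: Pred_def KPred_def)
        obtain K' where x_eq: "x = (v, K')" and K': "K' \<subseteq> K" "K' \<subseteq> Npos"
          using xy y by (cases x) (auto simp: eve_verts_def)
        \<comment> \<open>Downward closure of \<open>?Q\<close>: with less knowledge the same action
          works, and each successor is dominated by the same \<open>z\<close>.\<close>
        have "(v', K' \<inter> nabla A v a v') \<in> down A ?P ?L" if v': "v' \<in> verts A" for v'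
        proof -
          obtain z where "z \<in> ?L" "(v', K \<inter> nabla A v a v') \<preceq> z"
            using K[OF v'] unfolding down_eq[OF W_alt_Pow] by blast
          then have "(v', K' \<inter> nabla A v a v') \<preceq> z" using K' by (auto simp: kle_def)
          with \<open>z \<in> ?L\<close> show ?thesis
            using v' K' unfolding down_eq[OF W_alt_Pow] by (auto simp: eve_verts_def)
        qed
        then have "K' \<in> KPred A ?P v a (down A ?P ?L)" using K' by (simp add: KPred_def)
        then show ?thesis using v x_eq unfolding Pred_def by blast
      qed
    qed
  qed
  finally show ?case using Suc by simp
qed

lemma win_within_iff:
  "(v, K) \<in> win_within i \<longleftrightarrow>
     v \<in> verts A \<and> K \<subseteq> Npos \<and> (\<exists>K'. (v, K') \<in> W_alt A t i \<and> K \<subseteq> K')"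
proof -
  have "(\<exists>y\<in>L. (v, K) \<preceq> y) \<longleftrightarrow> (\<exists>K'. (v, K') \<in> L \<and> K \<subseteq> K')" for L
    by (simp add: Bex_def)
  then show ?thesis
    unfolding down_W_alt[symmetric] down_eq[OF W_alt_Pow] by (simp add: eve_verts_def)
qed

lemma win_within_mono: "i \<le> j \<Longrightarrow> win_within i \<subseteq> win_within j"
  by (rule lift_Suc_mono_le) auto

text \<open>Restricted to a finite coherent set, the downward closures form an increasing sequence
  in a finite powerset and become constant; the antichains are their maximal elements.\<close>

lemma W_alt_stabilises: "\<exists>n. \<forall>i\<ge>n. W_alt A t i = W_alt A t n"
proof -
  obtain \<K> where \<K>: "finite \<K>" "coherent A \<K>" using finite_coherent_exists[OF arena] by blast
  define D where "D i = win_within i \<inter> eve_verts A \<K>" for i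
  have fin: "finite (eve_verts A \<K>)"
    using \<K> arena by (simp add: eve_verts_def param_arena_def)
  have "down A \<K> (W_alt A t i) = D i" for i
  proof -
    have "eve_verts A \<K> \<subseteq> eve_verts A (Pow Npos)"
      using \<K> by (auto simp: eve_verts_def coherent_def)
    then show ?thesis
      unfolding D_def down_W_alt[symmetric] down_eq[OF W_alt_Pow] down_eq[OF W_alt_coherent[OF \<K>(2)]]
      by blast
  qed
  then have W_D: "W_alt A t i = maxl A \<K> (D i)" for i
    using maxl_down_antichain[OF antichain_W_alt W_alt_coherent[OF \<K>(2)]] by metis
  have "range D \<subseteq> Pow (eve_verts A \<K>)" unfolding D_def by blast
  then have "finite (range D)" by (rule finite_subset) (simp add: fin)
  from finite_has_maximal[OF this] obtain M where "M \<in> range D"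
    and max: "\<forall>B\<in>range D. M \<subseteq> B \<longrightarrow> M = B"
    by auto
  from this(1) obtain n where "M = D n" by (rule rangeE)
  with max have n: "D n \<subseteq> D i \<Longrightarrow> D n = D i" for i by simp
  have "D n = D i" if "i \<ge> n" for i
    using n[of i] win_within_mono[OF that] unfolding D_def by blast
  then show ?thesis unfolding W_D by metis
qed


section \<open>Winning the knowledge game\<close>

abbreviation wins_after :: "'v \<Rightarrow> nat set \<Rightarrow> 'a \<Rightarrow> nat \<Rightarrow> bool" where
  "wins_after v K a j \<equiv> \<forall>v'\<in>verts A. (v', K \<inter> nabla A v a v') \<in> win_within j"

lemma win_within_SucE:
  assumes "(v, K) \<in> win_within (Suc i)" "(v, K) \<notin> win_within i"
  obtains a where "a \<in> En A v" "wins_after v K a i"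
  using assms by (auto simp: Pred_def KPred_def)

lemma win_within_SucI:
  "v \<in> verts A \<Longrightarrow> K \<subseteq> Npos \<Longrightarrow> a \<in> En A v \<Longrightarrow> wins_after v K a i \<Longrightarrow> (v, K) \<in> win_within (Suc i)"
  by (auto simp: Pred_def KPred_def)

lemma edge_EveV:
  "(EveV v K, y) \<in> edges (knowledge_game A t) \<longleftrightarrow>
     (\<exists>a. y = AdamV v K a \<and> v \<in> verts A \<and> K \<subseteq> Npos \<and> a \<in> En A v)"
  by (auto simp: knowledge_game_def)

lemma edge_AdamV:
  "(AdamV v K a, y) \<in> edges (knowledge_game A t) \<longleftrightarrow>
     (\<exists>v'. y = EveV v' (K \<inter> nabla A v a v') \<and> v \<in> verts A \<and> K \<subseteq> Npos \<and> a \<in> acts A \<and>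
        v' \<in> verts A \<and> K \<inter> nabla A v a v' \<noteq> {})"
  by (auto simp: knowledge_game_def)

lemma win_within_imp_eve_wins:
  assumes complete: "complete_for_enabled A"
    and "(v, K) \<in> win_within i" "K \<noteq> {}"
  shows "eve_wins (knowledge_game A t) (EveV v K)"
proof -
  let ?G = "knowledge_game A t"
  \<comment> \<open>Empty knowledge is excluded: it is in \<open>win_within 0\<close> by convention,
    not because Eve wins there.\<close>
  define R where "R = {EveV v K | v K. K \<noteq> {} \<and> (\<exists>i. (v, K) \<in> win_within i)} \<union>
    {AdamV v K a | v K a. v \<in> verts A \<and> K \<subseteq> Npos \<and> K \<noteq> {} \<and> a \<in> En A v \<and> (\<exists>j. wins_after v K a j)}"
  \<comment> \<open>Doubling makes both kinds of move decrease the rank: Eve goes from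
    \<open>2 * Suc j\<close> to at most \<open>2 * j + 1\<close>, Adam from \<open>2 * m + 1\<close>
    to at most \<open>2 * m\<close>.\<close>
  define r where "r x = (case x of EveV v K \<Rightarrow> 2 * (LEAST i. (v, K) \<in> win_within i)
    | AdamV v K a \<Rightarrow> 2 * (LEAST j. wins_after v K a j) + 1)" for x
  show ?thesis
  proof (rule eve_wins_by_rank[of R _ r])
    fix x assume "x \<in> R" "x \<in> eve ?G" and nt: "x \<notin> targets ?G"
    then obtain v K where x: "x = EveV v K" "v \<in> verts A" "K \<subseteq> Npos" "K \<noteq> {}"
      and ex: "\<exists>i. (v, K) \<in> win_within i"
      by (auto simp: R_def knowledge_game_def)
    define m where "m = (LEAST i. (v, K) \<in> win_within i)"
    have m: "(v, K) \<in> win_within m" unfolding m_def by (rule LeastI_ex[OF ex])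
    \<comment> \<open>With \<open>K\<close> nonempty, only the target vertex is won at round
      0.\<close>
    have "m \<noteq> 0"
    proof
      assume "m = 0"
      then have "v = t" using m x by auto
      then show False using nt x by (auto simp: knowledge_game_def)
    qed
    then obtain j where j: "m = Suc j" by (cases m) auto
    then have "(v, K) \<notin> win_within j" by (intro not_less_Least) (simp flip: m_def)
    with m[unfolded j] obtain a where a: "a \<in> En A v" "wins_after v K a j"
      by (rule win_within_SucE)
    have "(LEAST j. wins_after v K a j) \<le> j" using a by (intro Least_le)
    then have "r (AdamV v K a) < r x" using j x by (simp add: r_def flip: m_def)
    moreover have "AdamV v K a \<in> R" using a x by (auto simp: R_def)
    ultimately show "\<exists>y. (x, y) \<in> edges ?G \<and> y \<in> R \<and> r y < r x"
      using a x by (auto simp: edge_EveV)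
  next
    fix x assume "x \<in> R" and "x \<notin> eve ?G" "x \<notin> targets ?G"
    then obtain v K a where x: "x = AdamV v K a" "v \<in> verts A" "K \<subseteq> Npos" "K \<noteq> {}" "a \<in> En A v"
      and ex: "\<exists>j. wins_after v K a j"
      by (auto simp: R_def knowledge_game_def win_within_iff)
    obtain k where k: "k \<in> K" "k \<in> Npos" using x by auto
    \<comment> \<open>Completeness supplies a successor for a parameter that is still possible, so
      Adam is not stuck before the target is reached.\<close>
    have "delta A v a k \<noteq> {}" using complete x k unfolding complete_for_enabled_def by blast
    moreover have "delta A v a k \<subseteq> verts A"
      using arena x k En_acts[of a A v] unfolding param_arena_def by blast
    ultimately obtain v' where "v' \<in> delta A v a k" "v' \<in> verts A" by blast
    then have "(x, EveV v' (K \<inter> nabla A v a v')) \<in> edges ?G"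
      using x k En_acts by (auto simp: edge_AdamV nabla_def)
    then have "\<not> deadlock ?G x" by (auto simp: deadlock_def)
    moreover have "y \<in> R \<and> r y < r x" if xy: "(x, y) \<in> edges ?G" for y
    proof -
      define m where "m = (LEAST j. wins_after v K a j)"
      have m: "wins_after v K a m" unfolding m_def by (rule LeastI_ex[OF ex])
      obtain v' where v': "v' \<in> verts A" "K \<inter> nabla A v a v' \<noteq> {}" "y = EveV v' (K \<inter> nabla A v a v')"
        using xy x by (auto simp: edge_AdamV)
      have w: "(v', K \<inter> nabla A v a v') \<in> win_within m" using m v' by blast
      then have "(LEAST i. (v', K \<inter> nabla A v a v') \<in> win_within i) \<le> m" by (rule Least_le)
      then show ?thesis using w v' x by (auto simp: R_def r_def simp flip: m_def)
    qed
    ultimately show "\<not> deadlock ?G x \<and> (\<forall>y. (x, y) \<in> edges ?G \<longrightarrow> y \<in> R \<and> r y < r x)" by blast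
  next
    show "EveV v K \<in> R" using assms by (auto simp: R_def)
  qed
qed

text \<open>The positions won in some number of rounds, together with the Adam vertices leading to
  them, satisfy the closure conditions of \<open>eve_wins_imp_in_closed\<close>.\<close>

lemma eve_wins_imp_win_within:
  assumes "v \<in> verts A" "K \<subseteq> Npos" "eve_wins (knowledge_game A t) (EveV v K)"
  shows "\<exists>i. (v, K) \<in> win_within i"
proof -
  let ?G = "knowledge_game A t"
  define R where "R = {EveV v K | v K. \<exists>i. (v, K) \<in> win_within i} \<union>
    {AdamV v K a | v K a. a \<in> En A v \<and> (\<exists>j. wins_after v K a j)}"
  have "EveV v K \<in> R"
  proof (rule eve_wins_imp_in_closed[of ?G])
    show "edges ?G \<subseteq> UNIV \<times> (eve ?G \<union> adam ?G)"
      by (auto simp: knowledge_game_def En_acts)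
    have "EveV t K \<in> R" if "K \<subseteq> Npos" for K
      using that target by (auto simp: R_def intro!: exI[of _ 0])
    then show "targets ?G \<subseteq> R" by (auto simp: knowledge_game_def)
  next
    fix x y assume "x \<in> eve ?G" "(x, y) \<in> edges ?G" "y \<in> R"
    then obtain v K a j where x: "x = EveV v K"
      and v: "v \<in> verts A" "K \<subseteq> Npos" "a \<in> En A v" "wins_after v K a j"
      by (auto simp: knowledge_game_def R_def)
    from v have "(v, K) \<in> win_within (Suc j)" by (rule win_within_SucI)
    then show "x \<in> R" unfolding R_def x by blast
  next
    fix x assume "x \<in> adam ?G" and live: "\<not> deadlock ?G x"
      and succ: "\<And>y. (x, y) \<in> edges ?G \<Longrightarrow> y \<in> R"
    then obtain v K a where x: "x = AdamV v K a" "v \<in> verts A" "K \<subseteq> Npos" "a \<in> acts A"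
      by (auto simp: knowledge_game_def)
    \<comment> \<open>Adam's vertices carry arbitrary actions; a move available to Adam shows that
      this one is enabled.\<close>
    obtain v' where "K \<inter> nabla A v a v' \<noteq> {}"
      using live x by (auto simp: deadlock_def edge_AdamV)
    then have "a \<in> En A v" using x by (auto simp: En_def nabla_def)
    have "\<exists>j. (v', K \<inter> nabla A v a v') \<in> win_within j" if "v' \<in> verts A" for v'
    proof (cases "K \<inter> nabla A v a v' = {}")
      case True
      then have "(v', K \<inter> nabla A v a v') \<in> win_within 0" using that by simp
      then show ?thesis by blast
    next
      case False
      then have "EveV v' (K \<inter> nabla A v a v') \<in> R"
        using succ x that by (auto simp: edge_AdamV)
      then show ?thesis by (auto simp: R_def)
    qed
    then obtain j where j: "\<And>v'. v' \<in> verts A \<Longrightarrow> (v', K \<inter> nabla A v a v') \<in> win_within (j v')"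
      by metis
    \<comment> \<open>The finitely many round bounds of the successors have a common maximum, and
      \<open>win_within\<close> is monotone.\<close>
    have "j v' \<le> Max (j ` verts A)" if "v' \<in> verts A" for v'
      using arena that by (simp add: param_arena_def)
    then have "wins_after v K a (Max (j ` verts A))"
      using j win_within_mono by blast
    then show "x \<in> R" using x \<open>a \<in> En A v\<close> unfolding R_def by blast
  next
    show "EveV v K \<in> eve ?G \<union> adam ?G" using assms by (simp add: knowledge_game_def)
  qed (rule assms)
  then show ?thesis by (simp add: R_def)
qed

end

section \<open>Eventual values and the description of the winning region\<close>

lemma eventual_value_eq:
  assumes "\<And>i. i \<ge> n \<Longrightarrow> X i = c"
  shows "eventually_constant X" "eventual_value X = c"
proof -
  have ev: "\<forall>\<^sub>F i in sequentially. X i = c"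
    using assms by (auto simp: eventually_sequentially)
  then show "eventually_constant X" unfolding eventually_constant_def by blast
  have "d = c" if "\<forall>\<^sub>F i in sequentially. X i = d" for d
    using eventually_happens[OF eventually_conj[OF that ev]] by auto
  with ev show "eventual_value X = c" unfolding eventual_value_def by (rule the_equality)
qed

theorem theorem22:
  fixes A :: "('v, 'a) arena" and t :: 'v and \<K> :: "nat set set"
  assumes "param_arena A"
    and "complete_for_enabled A"
    and "t \<in> verts A"
    and "coherent A \<K>"
  shows "eventually_constant (W A t) \<and>
         eventually_constant (W_alt A t) \<and>
         eventually_constant (W_coh A t \<K>) \<and>
         antichain (eventual_value (W A t)) \<and>
         eventual_value (W_alt A t) = eventual_value (W A t) \<and>
         eventual_value (W_coh A t \<K>) = eventual_value (W A t) \<and>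
         (\<forall>v\<in>verts A. \<forall>K. K \<noteq> {} \<and> K \<subseteq> Npos \<longrightarrow>
            (eve_wins (knowledge_game A t) (EveV v K) \<longleftrightarrow>
             (\<exists>K'. (v, K') \<in> eventual_value (W A t) \<and> K \<subseteq> K')))"
proof -
  note arena = assms(1) and target = assms(3)
  obtain n where n: "\<And>i. i \<ge> n \<Longrightarrow> W_alt A t i = W_alt A t n"
    using W_alt_stabilises[OF arena target] by blast
  have W: "W A t = W_alt A t" and W_coh: "W_coh A t \<K> = W_alt A t"
    using W_coh_eq_W_alt[OF arena target] coherent_Pow assms(4) by (auto simp: W_def)
  have const: "eventually_constant (W_alt A t)" and val: "eventual_value (W_alt A t) = W_alt A t n"
    by (rule eventual_value_eq[of n "W_alt A t", OF n], assumption)+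
  have "eve_wins (knowledge_game A t) (EveV v K) \<longleftrightarrow> (\<exists>K'. (v, K') \<in> W_alt A t n \<and> K \<subseteq> K')"
    if v: "v \<in> verts A" and K: "K \<noteq> {}" "K \<subseteq> Npos" for v K
  proof
    assume "eve_wins (knowledge_game A t) (EveV v K)"
    then obtain i where "(v, K) \<in> win_within A t i"
      using eve_wins_imp_win_within[OF arena target v K(2)] by blast
    \<comment> \<open>Index \<open>max i n\<close> is large enough both to contain
      \<open>(v, K)\<close> and for the antichain to have stabilised.\<close>
    then have "(v, K) \<in> win_within A t (max i n)"
      using win_within_mono[OF arena target, of i "max i n"] by auto
    then show "\<exists>K'. (v, K') \<in> W_alt A t n \<and> K \<subseteq> K'"
      unfolding win_within_iff[OF arena target] n[OF max.cobounded2] by blast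
  next
    assume "\<exists>K'. (v, K') \<in> W_alt A t n \<and> K \<subseteq> K'"
    then have "(v, K) \<in> win_within A t n"
      using v K by (simp add: win_within_iff[OF arena target])
    then show "eve_wins (knowledge_game A t) (EveV v K)"
      using win_within_imp_eve_wins[OF arena target assms(2)] K by blast
  qed
  then show ?thesis
    using const antichain_W_alt[OF arena target] by (simp add: W W_coh val)
qed

end
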